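(* Let $H$ be a Hilbert space. Then the class $\mathcal{C}_{SPC}(H)$ of all strictly pseudocontractive mappings $T:H\to H$ is a saturated class of mappings, i.e. $\mathcal{C}_{SPC}(H)=\mathcal{C}_{SPC}^{e}(H)$.
   Context: For a self mapping $T:X\to X$ of a linear normed space $(X,\|\cdot\|)$ and $\lambda\in(0,1]$, the averaged mapping $T_\lambda:X\to X$ is $T_\lambda x=(1-\lambda)x+\lambda Tx$. If $\mathcal{C}$ is a subset of the family of all self mappings of $X$, a mapping $T:X\to X$ is called $\mathcal{C}$-enriched if there exists $\lambda\in(0,1]$ such that $T_\lambda\in\mathcal{C}$; $\mathcal{C}^{e}$ denotes the set of all $\mathcal{C}$-enriched mappings. One always has $\mathcal{C}\subseteq\mathcal{C}^{e}$ (take $\lambda=1$). The class $\mathcal{C}$ is called unsaturated if the inclusion $\mathcal{C}\subset\mathcal{C}^{e}$ is strict, and saturated if $\mathcal{C}=\mathcal{C}^{e}$. A mapping $T:X\to X$ is strictly pseudocontractive if there exists $k\in(0,1)$ such that $\|Tx-Ty\|^2\le\|x-y\|^2+k\,\|x-y-(Tx-Ty)\|^2$ for all $x,y\in X$. $\mathcal{C}_{SPC}(X)$ denotes the class of all strictly pseudocontractive mappings on $X$, and $\mathcal{C}_{SPC}^{e}(X)=(\mathcal{C}_{SPC}(X))^{e}$. *)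

theory Defs
  imports "HOL-Analysis.Inner_Product"
begin

definition averaged :: "real \<Rightarrow> ('a::real_normed_vector \<Rightarrow> 'a) \<Rightarrow> 'a \<Rightarrow> 'a" where
  "averaged \<mu> T = (\<lambda>x. (1 - \<mu>) *\<^sub>R x + \<mu> *\<^sub>R T x)"

definition enriched :: "('a::real_normed_vector \<Rightarrow> 'a) set \<Rightarrow> ('a \<Rightarrow> 'a) set" where
  "enriched C = {T. \<exists>\<mu>\<in>{0<..1}. averaged \<mu> T \<in> C}"

definition saturated :: "('a::real_normed_vector \<Rightarrow> 'a) set \<Rightarrow> bool" where
  "saturated C \<longleftrightarrow> C = enriched C"

definition strictly_pseudocontractive :: "('a::real_normed_vector \<Rightarrow> 'a) \<Rightarrow> bool" where
  "strictly_pseudocontractive T \<longleftrightarrow>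
     (\<exists>k\<in>{0<..<1}. \<forall>x y.
        (norm (T x - T y))\<^sup>2 \<le> (norm (x - y))\<^sup>2 + k * (norm (x - y - (T x - T y)))\<^sup>2)"

definition C_SPC :: "('a::real_normed_vector \<Rightarrow> 'a) set" where
  "C_SPC = {T. strictly_pseudocontractive T}"

end

theory Submission
  imports Defs
begin

text \<open>In an inner product space, strict pseudocontractivity of \<open>T\<close> says that \<open>I - T\<close> is cocoercive:
  \<open>c \<parallel>u\<parallel>\<^sup>2 \<le> 2 \<langle>x - y, u\<rangle>\<close> with \<open>u = (I - T) x - (I - T) y\<close> and \<open>c = 1 - k\<close>. Averaging replaces
  \<open>I - T\<close> by \<open>\<mu> (I - T)\<close>, and the condition for \<open>\<mu> u\<close> with constant \<open>c\<close> is the condition for \<open>u\<close>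
  with constant \<open>c \<mu>\<close>.\<close>

unbundle inner_syntax

lemma strictly_pseudocontractive_iff_cocoercive:
  fixes T :: "'h::real_inner \<Rightarrow> 'h"
  shows "strictly_pseudocontractive T \<longleftrightarrow>
    (\<exists>c\<in>{0<..<1}. \<forall>x y.
       c * (norm (x - y - (T x - T y)))\<^sup>2 \<le> 2 * ((x - y) \<bullet> (x - y - (T x - T y))))"
proof -
  \<comment> \<open>Writing \<open>T x - T y = d - u\<close> and expanding the square,
    \<open>(norm d)\<^sup>2\<close> cancels and the two \<open>u\<close> terms merge into the factor
    \<open>1 - k\<close>.\<close>
  have expand: "(norm (T x - T y))\<^sup>2 \<le> (norm (x - y))\<^sup>2 + k * (norm (x - y - (T x - T y)))\<^sup>2 \<longleftrightarrow>
      (1 - k) * (norm (x - y - (T x - T y)))\<^sup>2 \<le> 2 * ((x - y) \<bullet> (x - y - (T x - T y)))"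
    for x y k
  proof -
    define d u where "d = x - y" and "u = x - y - (T x - T y)"
    have "T x - T y = d - u" by (simp add: d_def u_def)
    then have "(norm (T x - T y))\<^sup>2 = (norm d)\<^sup>2 - 2 * (d \<bullet> u) + (norm u)\<^sup>2"
      by (simp add: power2_norm_eq_inner inner_diff inner_commute)
    then show ?thesis
      unfolding u_def[symmetric] unfolding d_def[symmetric] by (auto simp: left_diff_distrib)
  qed
  \<comment> \<open>The map \<open>k \<mapsto> 1 - k\<close> is an involution of the open unit
    interval.\<close>
  have reflect: "(\<exists>k\<in>{0<..<1}. P (1 - k)) \<longleftrightarrow> (\<exists>c\<in>{0<..<1}. P c)" for P :: "real \<Rightarrow> bool"
  proof
    assume "\<exists>c\<in>{0<..<1}. P c"
    then obtain c where "c \<in> {0<..<1}" "P c" by blast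
    then show "\<exists>k\<in>{0<..<1}. P (1 - k)" by (intro bexI[of _ "1 - c"]) auto
  qed force
  show ?thesis
    unfolding strictly_pseudocontractive_def expand by (rule reflect)
qed

lemma averaged_1: "averaged 1 T = T"
  by (simp add: averaged_def)

text \<open>The witness is \<open>\<mu> = 1\<close>, where averaging changes nothing.\<close>

lemma subset_enriched: "C \<subseteq> enriched C"
  by (force simp: enriched_def averaged_1)

lemma averaged_displacement_diff:
  "x - y - (averaged \<mu> T x - averaged \<mu> T y) = \<mu> *\<^sub>R (x - y - (T x - T y))"
  by (simp add: averaged_def algebra_simps)

lemma strictly_pseudocontractive_if_averaged:
  fixes T :: "'h::real_inner \<Rightarrow> 'h"
  assumes \<mu>: "0 < \<mu>" "\<mu> \<le> 1" and "strictly_pseudocontractive (averaged \<mu> T)"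
  shows "strictly_pseudocontractive T"
proof -
  obtain c where c: "0 < c" "c < 1"
    and coco: "\<And>x y. c * (norm (\<mu> *\<^sub>R (x - y - (T x - T y))))\<^sup>2
      \<le> 2 * ((x - y) \<bullet> (\<mu> *\<^sub>R (x - y - (T x - T y))))"
    using assms(3)
    unfolding strictly_pseudocontractive_iff_cocoercive averaged_displacement_diff by auto
  have "(c * \<mu>) * (norm (x - y - (T x - T y)))\<^sup>2 \<le> 2 * ((x - y) \<bullet> (x - y - (T x - T y)))" for x y
  proof -
    define d u where "d = x - y" and "u = x - y - (T x - T y)"
    \<comment> \<open>The square yields \<open>\<mu>\<^sup>2\<close> but the inner product only
      \<open>\<mu>\<close>; cancelling one positive factor leaves \<open>c * \<mu>\<close>.\<close>
    have "\<mu> * ((c * \<mu>) * (norm u)\<^sup>2) = c * (norm (\<mu> *\<^sub>R u))\<^sup>2"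
      by (simp add: power_mult_distrib power2_eq_square)
    also have "\<dots> \<le> 2 * (d \<bullet> (\<mu> *\<^sub>R u))"
      using coco unfolding d_def u_def .
    also have "\<dots> = \<mu> * (2 * (d \<bullet> u))"
      by simp
    finally show ?thesis
      using \<mu>(1) unfolding u_def[symmetric] unfolding d_def[symmetric] by (simp only: mult_le_cancel_left_pos)
  qed
  \<comment> \<open>Here \<open>\<mu> \<le> 1\<close> keeps the new constant in the open unit
    interval.\<close>
  moreover have "c * \<mu> < 1"
    using c \<mu> mult_left_le[of \<mu> c] by linarith
  ultimately show ?thesis
    unfolding strictly_pseudocontractive_iff_cocoercive
    using c(1) \<mu>(1) by (intro bexI[of _ "c * \<mu>"]) auto
qed

theorem theorem13:
  shows "saturated (C_SPC :: ('h::{real_inner, complete_space} \<Rightarrow> 'h) set)"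
proof -
  have "enriched C_SPC \<subseteq> (C_SPC :: ('h \<Rightarrow> 'h) set)"
    by (auto simp: enriched_def C_SPC_def intro: strictly_pseudocontractive_if_averaged)
  then show ?thesis
    unfolding saturated_def using subset_enriched by blast
qed

end
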